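(* Let $\mathcal{C}$ be a locally finite category. Let $\mathcal{I}$ be a subclass of the class of monomorphisms of $\mathcal{C}$ that contains all identities; its members are called $\mathcal{I}$-monos. For each object $X$ of $\mathcal{C}$, let a subclass of the class of all supobjects $q\colon X\to Q$ of $X$ be specified; its members are called the $\mathcal{M}$-supobjects of $X$. Suppose that the following conditions hold. (1) For any object $X$ and any finite number of $\mathcal{M}$-supobjects $e_i\colon X\to Q_i$, $i=1,2,\ldots,m$, there exists a pushout of $e_1,\ldots,e_m$ in $\mathcal{C}$. (2) For any object, the set of isomorphism classes of its $\mathcal{M}$-supobjects is finite. (3) If a morphism $f\colon X\to Y$ is not $\mathcal{I}$-mono, then it factors through an $\mathcal{M}$-supobject $X\to Q$. (4) If a morphism $f\colon X\to Y$ factors through an $\mathcal{M}$-supobject $X\to Q$, then $f$ is not $\mathcal{I}$-mono. Then $\mathcal{C}$ is combinatorial.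
   Context: A category $\mathcal{C}$ is locally finite if $\operatorname{Hom}(A,B)$ is a finite set for all objects $A,B$. A locally finite category $\mathcal{C}$ is combinatorial if for all objects $A,B$: whenever $|\operatorname{Hom}(X,A)|=|\operatorname{Hom}(X,B)|$ holds for all objects $X$, then $A$ is isomorphic to $B$. A supobject of an object $X$ is an epimorphism $q\colon X\to Q$. Two supobjects $q\colon X\to Q$ and $q'\colon X\to Q'$ are isomorphic if there is an isomorphism $h\colon Q\to Q'$ with $q'=h\circ q$. A morphism $f\colon X\to Y$ factors through a supobject $q\colon X\to Q$ if $f=g\circ q$ for some $g\colon Q\to Y$. The pushout of finitely many morphisms $e_i\colon X\to Q_i$ with common domain means the (wide) pushout, i.e. the colimit of the diagram consisting of the $e_i$. The specified class of $\mathcal{M}$-supobjects is allowed to be empty. *)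

theory Defs
  imports Main
begin

text \<open>
  Categories with explicit classes of objects and morphisms. Every morphism determines its domain
  and codomain, so hom-sets are pairwise disjoint. The value of \<open>g \<cdot> f\<close> is only constrained when
  \<open>f\<close> and \<open>g\<close> are composable.
\<close>

record ('o, 'm) cat =
  Obj  :: "'o set"
  Arr  :: "'m set"
  Dom  :: "'m \<Rightarrow> 'o"
  Cod  :: "'m \<Rightarrow> 'o"
  Id   :: "'o \<Rightarrow> 'm"
  Comp :: "'m \<Rightarrow> 'm \<Rightarrow> 'm"  (infixl "\<cdot>\<index>" 70)

definition Hom :: "('o, 'm, 'x) cat_scheme \<Rightarrow> 'o \<Rightarrow> 'o \<Rightarrow> 'm set"
  where "Hom C A B = {f \<in> Arr C. Dom C f = A \<and> Cod C f = B}"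

locale category =
  fixes C :: "('o, 'm, 'x) cat_scheme" (structure)
  assumes Dom_in_Obj: "f \<in> Arr C \<Longrightarrow> Dom C f \<in> Obj C"
    and Cod_in_Obj: "f \<in> Arr C \<Longrightarrow> Cod C f \<in> Obj C"
    and Id_in_Hom: "A \<in> Obj C \<Longrightarrow> Id C A \<in> Hom C A A"
    and Comp_in_Hom: "\<lbrakk>f \<in> Hom C A B; g \<in> Hom C B D\<rbrakk> \<Longrightarrow> g \<cdot> f \<in> Hom C A D"
    and Comp_Id: "f \<in> Hom C A B \<Longrightarrow> f \<cdot> Id C A = f"
    and Id_Comp: "f \<in> Hom C A B \<Longrightarrow> Id C B \<cdot> f = f"
    and Comp_assoc: "\<lbrakk>f \<in> Hom C A B; g \<in> Hom C B D; h \<in> Hom C D E\<rbrakk>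
      \<Longrightarrow> (h \<cdot> g) \<cdot> f = h \<cdot> (g \<cdot> f)"

definition mono_arr :: "('o, 'm, 'x) cat_scheme \<Rightarrow> 'm \<Rightarrow> bool"
  where "mono_arr C f \<longleftrightarrow> f \<in> Arr C \<and>
    (\<forall>Z\<in>Obj C. \<forall>u\<in>Hom C Z (Dom C f). \<forall>v\<in>Hom C Z (Dom C f).
      f \<cdot>\<^bsub>C\<^esub> u = f \<cdot>\<^bsub>C\<^esub> v \<longrightarrow> u = v)"

definition epi_arr :: "('o, 'm, 'x) cat_scheme \<Rightarrow> 'm \<Rightarrow> bool"
  where "epi_arr C f \<longleftrightarrow> f \<in> Arr C \<and>
    (\<forall>Z\<in>Obj C. \<forall>u\<in>Hom C (Cod C f) Z. \<forall>v\<in>Hom C (Cod C f) Z.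
      u \<cdot>\<^bsub>C\<^esub> f = v \<cdot>\<^bsub>C\<^esub> f \<longrightarrow> u = v)"

definition iso_arr :: "('o, 'm, 'x) cat_scheme \<Rightarrow> 'm \<Rightarrow> bool"
  where "iso_arr C f \<longleftrightarrow> f \<in> Arr C \<and>
    (\<exists>g\<in>Hom C (Cod C f) (Dom C f).
      g \<cdot>\<^bsub>C\<^esub> f = Id C (Dom C f) \<and> f \<cdot>\<^bsub>C\<^esub> g = Id C (Cod C f))"

definition isomorphic_objects :: "('o, 'm, 'x) cat_scheme \<Rightarrow> 'o \<Rightarrow> 'o \<Rightarrow> bool"
  where "isomorphic_objects C A B \<longleftrightarrow> (\<exists>f\<in>Hom C A B. iso_arr C f)"

locale locally_finite_category = category +
  assumes finite_Hom: "\<lbrakk>A \<in> Obj C; B \<in> Obj C\<rbrakk> \<Longrightarrow> finite (Hom C A B)"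

locale combinatorial_category = locally_finite_category +
  assumes iso_if_card_Hom_eq:
    "\<lbrakk>A \<in> Obj C; B \<in> Obj C; \<forall>X\<in>Obj C. card (Hom C X A) = card (Hom C X B)\<rbrakk>
      \<Longrightarrow> isomorphic_objects C A B"

definition supobjects :: "('o, 'm, 'x) cat_scheme \<Rightarrow> 'o \<Rightarrow> 'm set"
  where "supobjects C X = {q. epi_arr C q \<and> Dom C q = X}"

definition isomorphic_supobjects :: "('o, 'm, 'x) cat_scheme \<Rightarrow> 'm \<Rightarrow> 'm \<Rightarrow> bool"
  where "isomorphic_supobjects C q q' \<longleftrightarrow>
    (\<exists>h\<in>Hom C (Cod C q) (Cod C q'). iso_arr C h \<and> q' = h \<cdot>\<^bsub>C\<^esub> q)"

definition supobject_iso_classes :: "('o, 'm, 'x) cat_scheme \<Rightarrow> 'm set \<Rightarrow> 'm set set"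
  where "supobject_iso_classes C S =
    S // {(q, q'). q \<in> S \<and> q' \<in> S \<and> isomorphic_supobjects C q q'}"

definition factors_through :: "('o, 'm, 'x) cat_scheme \<Rightarrow> 'm \<Rightarrow> 'm \<Rightarrow> bool"
  where "factors_through C f q \<longleftrightarrow> (\<exists>g\<in>Hom C (Cod C q) (Cod C f). f = g \<cdot>\<^bsub>C\<^esub> q)"

text \<open>
  Cocones and colimits of the diagram consisting of \<open>e 1, \<dots>, e m\<close> with common domain \<open>X\<close>. The leg
  \<open>p\<close> at \<open>X\<close> is redundant for \<open>m \<ge> 1\<close>; for \<open>m = 0\<close> the diagram is the single object \<open>X\<close>, whose colimit
  always exists and is \<open>X\<close> itself.
\<close>

definition is_cocone ::
    "('o, 'm, 'x) cat_scheme \<Rightarrow> 'o \<Rightarrow> nat \<Rightarrow> (nat \<Rightarrow> 'm) \<Rightarrow> 'o \<Rightarrow> 'm \<Rightarrow> (nat \<Rightarrow> 'm) \<Rightarrow> bool"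
  where "is_cocone C X m e P p j \<longleftrightarrow> P \<in> Obj C \<and> p \<in> Hom C X P \<and>
    (\<forall>i\<in>{1..m}. j i \<in> Hom C (Cod C (e i)) P \<and> j i \<cdot>\<^bsub>C\<^esub> e i = p)"

definition is_pushout ::
    "('o, 'm, 'x) cat_scheme \<Rightarrow> 'o \<Rightarrow> nat \<Rightarrow> (nat \<Rightarrow> 'm) \<Rightarrow> 'o \<Rightarrow> 'm \<Rightarrow> (nat \<Rightarrow> 'm) \<Rightarrow> bool"
  where "is_pushout C X m e P p j \<longleftrightarrow> is_cocone C X m e P p j \<and>
    (\<forall>P' p' j'. is_cocone C X m e P' p' j' \<longrightarrow>
      (\<exists>!h. h \<in> Hom C P P' \<and> h \<cdot>\<^bsub>C\<^esub> p = p' \<and> (\<forall>i\<in>{1..m}. h \<cdot>\<^bsub>C\<^esub> j i = j' i)))"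

end

theory Submission
  imports Defs
begin

text \<open>
  Fix an object \<open>X\<close>. The hypotheses \<open>not_I_factors\<close> and \<open>factors_not_I\<close> say that the \<open>I\<close>-monos
  \<open>X \<rightarrow> A\<close> are exactly the morphisms that factor through none of the \<open>M\<close>-supobjects of \<open>X\<close>.
  Isomorphic supobjects have the same morphisms factoring through them, so by \<open>finite_classes\<close>
  only finitely many supobjects have to be avoided. The morphisms
  \<open>X \<rightarrow> A\<close> that factor through each of given \<open>M\<close>-supobjects \<open>e 1, \<dots>, e m\<close> correspond to the morphisms \<open>P \<rightarrow> A\<close> from their pushout \<open>P\<close>
  (\<open>bij_betw_pushout_factoring\<close>). Hence inclusion-exclusion (\<open>card_avoiding_eq\<close>) expresses the
  number of \<open>I\<close>-monos \<open>X \<rightarrow> A\<close> in terms of the numbers \<open>card (Hom C P A)\<close>, with pushouts \<open>P\<close>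
  that depend on \<open>X\<close> but not on \<open>A\<close>.

  If \<open>card (Hom C X A) = card (Hom C X B)\<close> for all \<open>X\<close>, then \<open>A\<close> and \<open>B\<close> therefore receive the
  same number of \<open>I\<close>-monos from every object. The identity of \<open>A\<close> is an \<open>I\<close>-mono, so there is an
  \<open>I\<close>-mono \<open>A \<rightarrow> B\<close>, and likewise one \<open>B \<rightarrow> A\<close>. In a locally finite category, monomorphisms in
  both directions force an isomorphism (\<open>isomorphic_objects_if_monos_both_ways\<close>).
\<close>

text \<open>
  This is inclusion-exclusion without signs. The elements that satisfy all conditions in \<open>T\<close> and
  none in \<open>insert a S\<close> are those that satisfy \<open>T\<close> and avoid \<open>S\<close>, minus those that satisfy
  \<open>insert a T\<close> and avoid \<open>S\<close>. Each step of the induction on \<open>S\<close> thus enlarges \<open>T\<close>, which is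
  why conditions to satisfy are carried along with the conditions to avoid.
\<close>

lemma card_avoiding_eq:
  fixes F :: "'q \<Rightarrow> 'a \<Rightarrow> bool" and G :: "'q \<Rightarrow> 'b \<Rightarrow> bool"
  assumes "finite S" and "finite H" and "finite K" and "S \<subseteq> R" and "finite T" and "T \<subseteq> R"
    and count_eq: "\<And>T. \<lbrakk>finite T; T \<subseteq> R\<rbrakk>
      \<Longrightarrow> card {x \<in> H. \<forall>q\<in>T. F q x} = card {y \<in> K. \<forall>q\<in>T. G q y}"
  shows "card {x \<in> H. (\<forall>q\<in>T. F q x) \<and> (\<forall>q\<in>S. \<not> F q x)}
       = card {y \<in> K. (\<forall>q\<in>T. G q y) \<and> (\<forall>q\<in>S. \<not> G q y)}"
  using \<open>finite S\<close> \<open>S \<subseteq> R\<close> \<open>finite T\<close> \<open>T \<subseteq> R\<close>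
proof (induction S arbitrary: T rule: finite_induct)
  case empty
  then show ?case using count_eq by simp
next
  case (insert a S)
  have split: "card {x \<in> L. (\<forall>q\<in>T. E q x) \<and> (\<forall>q\<in>insert a S. \<not> E q x)}
      = card {x \<in> L. (\<forall>q\<in>T. E q x) \<and> (\<forall>q\<in>S. \<not> E q x)}
        - card {x \<in> L. (\<forall>q\<in>insert a T. E q x) \<and> (\<forall>q\<in>S. \<not> E q x)}"
    if "finite L" for L :: "'c set" and E :: "'q \<Rightarrow> 'c \<Rightarrow> bool"
  proof -
    have "{x \<in> L. (\<forall>q\<in>T. E q x) \<and> (\<forall>q\<in>insert a S. \<not> E q x)}
        = {x \<in> L. (\<forall>q\<in>T. E q x) \<and> (\<forall>q\<in>S. \<not> E q x)}
          - {x \<in> L. (\<forall>q\<in>insert a T. E q x) \<and> (\<forall>q\<in>S. \<not> E q x)}"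
      by blast
    then show ?thesis
      using that by (simp add: card_Diff_subset subset_iff)
  qed
  show ?case
    unfolding split[OF \<open>finite H\<close>] split[OF \<open>finite K\<close>]
    using insert.IH[of T] insert.IH[of "insert a T"] insert.prems by auto
qed

context category
begin

lemma Hom_Obj:
  assumes "f \<in> Hom C A B"
  shows "A \<in> Obj C" and "B \<in> Obj C"
  using assms Dom_in_Obj Cod_in_Obj by (auto simp: Hom_def)

lemma Hom_DomCod:
  assumes "f \<in> Hom C A B"
  shows "Dom C f = A" and "Cod C f = B"
  using assms by (auto simp: Hom_def)

lemma supobject_in_Hom:
  assumes "q \<in> supobjects C X"
  shows "q \<in> Hom C X (Cod C q)"
  using assms by (auto simp: supobjects_def epi_arr_def Hom_def)

lemma epi_arr_cancel:
  assumes "epi_arr C q" and "u \<in> Hom C (Cod C q) Z" and "v \<in> Hom C (Cod C q) Z"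
    and "u \<cdot> q = v \<cdot> q"
  shows "u = v"
  using assms Hom_Obj(2)[OF assms(2)] unfolding epi_arr_def by blast

lemma mono_arr_cancel:
  assumes "mono_arr C f" and "f \<in> Hom C A B" and "u \<in> Hom C Z A" and "v \<in> Hom C Z A"
    and "f \<cdot> u = f \<cdot> v"
  shows "u = v"
  using assms Hom_Obj(1)[OF assms(3)] Hom_DomCod(1)[OF assms(2)] unfolding mono_arr_def by blast

lemma mono_arr_Comp:
  assumes "mono_arr C f" and "mono_arr C g" and f: "f \<in> Hom C A B" and g: "g \<in> Hom C B D"
  shows "mono_arr C (g \<cdot> f)"
proof -
  have gf: "g \<cdot> f \<in> Hom C A D" using Comp_in_Hom[OF f g] .
  have "u = v" if u: "u \<in> Hom C Z A" and v: "v \<in> Hom C Z A" and "(g \<cdot> f) \<cdot> u = (g \<cdot> f) \<cdot> v"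
    for Z u v
  proof -
    have "g \<cdot> (f \<cdot> u) = g \<cdot> (f \<cdot> v)"
      using that Comp_assoc[OF u f g] Comp_assoc[OF v f g] by simp
    then have "f \<cdot> u = f \<cdot> v"
      using mono_arr_cancel[OF \<open>mono_arr C g\<close> g] Comp_in_Hom[OF u f] Comp_in_Hom[OF v f] by blast
    then show ?thesis using mono_arr_cancel[OF \<open>mono_arr C f\<close> f u v] by blast
  qed
  then show ?thesis
    using gf Hom_DomCod[OF gf] by (auto simp: mono_arr_def Hom_def)
qed

text \<open>
  The supobjects \<open>e i\<close> are epimorphisms, so a morphism that factors through all of them does so in a
  unique way; its factors form a cocone, that is, a morphism from the pushout. The epimorphism
  property also makes composition with \<open>p\<close> injective, because the value on \<open>p\<close> determines the
  values on all legs \<open>j i\<close>. For \<open>m = 0\<close> this says that \<open>Hom C X A\<close> is in bijection with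
  \<open>Hom C P A\<close>.
\<close>

lemma bij_betw_pushout_factoring:
  assumes po: "is_pushout C X m e P p j"
    and e: "\<And>i. i \<in> {1..m} \<Longrightarrow> e i \<in> supobjects C X"
  shows "bij_betw (\<lambda>h. h \<cdot> p) (Hom C P A) {f \<in> Hom C X A. \<forall>i\<in>{1..m}. factors_through C f (e i)}"
proof (rule bij_betw_imageI)
  have p: "p \<in> Hom C X P" using po by (auto simp: is_pushout_def is_cocone_def)
  have j: "j i \<in> Hom C (Cod C (e i)) P" and je: "j i \<cdot> e i = p" if "i \<in> {1..m}" for i
    using po that by (auto simp: is_pushout_def is_cocone_def)
  have univ: "\<exists>!h. h \<in> Hom C P P' \<and> h \<cdot> p = p' \<and> (\<forall>i\<in>{1..m}. h \<cdot> j i = j' i)"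
    if "is_cocone C X m e P' p' j'" for P' p' j'
    using po that by (auto simp: is_pushout_def)
  have hje: "(h \<cdot> j i) \<cdot> e i = h \<cdot> p" if h: "h \<in> Hom C P A" and i: "i \<in> {1..m}" for h i
    using Comp_assoc[OF supobject_in_Hom[OF e[OF i]] j[OF i] h] je[OF i] by simp
  show "inj_on (\<lambda>h. h \<cdot> p) (Hom C P A)"
  proof (rule inj_onI)
    fix h k
    assume h: "h \<in> Hom C P A" and k: "k \<in> Hom C P A" and eq: "h \<cdot> p = k \<cdot> p"
    have hk: "h \<cdot> j i = k \<cdot> j i" if i: "i \<in> {1..m}" for i
    proof (rule epi_arr_cancel)
      show "epi_arr C (e i)" using e[OF i] by (simp add: supobjects_def)
      show "h \<cdot> j i \<in> Hom C (Cod C (e i)) A" "k \<cdot> j i \<in> Hom C (Cod C (e i)) A"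
        using Comp_in_Hom[OF j[OF i]] h k by auto
      show "(h \<cdot> j i) \<cdot> e i = (k \<cdot> j i) \<cdot> e i" using hje h k i eq by simp
    qed
    have "is_cocone C X m e A (h \<cdot> p) (\<lambda>i. h \<cdot> j i)"
      unfolding is_cocone_def
      using Hom_Obj(2)[OF h] Comp_in_Hom[OF p h] Comp_in_Hom[OF j h] hje[OF h] by blast
    from univ[OF this] show "h = k" using h k eq hk by metis
  qed
  show "(\<lambda>h. h \<cdot> p) ` Hom C P A = {f \<in> Hom C X A. \<forall>i\<in>{1..m}. factors_through C f (e i)}"
  proof (intro equalityI subsetI)
    fix f
    assume "f \<in> (\<lambda>h. h \<cdot> p) ` Hom C P A"
    then obtain h where h: "h \<in> Hom C P A" and f: "f = h \<cdot> p" by blast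
    have fA: "f \<in> Hom C X A" using f Comp_in_Hom[OF p h] by simp
    have "factors_through C f (e i)" if i: "i \<in> {1..m}" for i
      unfolding factors_through_def Hom_DomCod[OF fA]
      using hje[OF h i] f Comp_in_Hom[OF j[OF i] h] by metis
    then show "f \<in> {f \<in> Hom C X A. \<forall>i\<in>{1..m}. factors_through C f (e i)}" using fA by blast
  next
    fix f
    assume "f \<in> {f \<in> Hom C X A. \<forall>i\<in>{1..m}. factors_through C f (e i)}"
    then have f: "f \<in> Hom C X A" and "\<forall>i\<in>{1..m}. \<exists>g\<in>Hom C (Cod C (e i)) A. f = g \<cdot> e i"
      by (auto simp: factors_through_def Hom_DomCod)
    then obtain g where "\<forall>i\<in>{1..m}. g i \<in> Hom C (Cod C (e i)) A \<and> f = g i \<cdot> e i" by metis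
    then have "is_cocone C X m e A f g"
      unfolding is_cocone_def using f Hom_Obj(2)[OF f] by metis
    from univ[OF this] show "f \<in> (\<lambda>h. h \<cdot> p) ` Hom C P A" by blast
  qed
qed

lemma factors_through_isomorphic_supobject:
  assumes "isomorphic_supobjects C r q" and "r \<in> supobjects C X" and "f \<in> Hom C X A"
    and "factors_through C f q"
  shows "factors_through C f r"
proof -
  obtain h where h: "h \<in> Hom C (Cod C r) (Cod C q)" and q: "q = h \<cdot> r"
    using assms by (auto simp: isomorphic_supobjects_def)
  obtain g where g: "g \<in> Hom C (Cod C q) (Cod C f)" and "f = g \<cdot> q"
    using assms by (auto simp: factors_through_def)
  then have "f = (g \<cdot> h) \<cdot> r"
    using Comp_assoc[OF supobject_in_Hom[OF assms(2)] h g] q by simp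
  then show ?thesis using Comp_in_Hom[OF h g] by (auto simp: factors_through_def)
qed

lemma isomorphic_supobjects_refl:
  assumes "q \<in> supobjects C X"
  shows "isomorphic_supobjects C q q"
proof -
  have q: "q \<in> Hom C X (Cod C q)" using supobject_in_Hom[OF assms] .
  have I: "Id C (Cod C q) \<in> Hom C (Cod C q) (Cod C q)" using Id_in_Hom Hom_Obj(2)[OF q] .
  have "iso_arr C (Id C (Cod C q))"
    unfolding iso_arr_def Hom_DomCod[OF I] using I Comp_Id[OF I] by (auto simp: Hom_def)
  then show ?thesis unfolding isomorphic_supobjects_def using I Id_Comp[OF q] by metis
qed

text \<open>
  Inclusion-exclusion runs over a finite set of conditions, whereas \<open>S\<close> may be infinite. A
  representative of each isomorphism class suffices, as a morphism that factors through some
  member of \<open>S\<close> also factors through its representative.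
\<close>

lemma finite_supobject_representatives:
  assumes S: "S \<subseteq> supobjects C X" and fin: "finite (supobject_iso_classes C S)"
  obtains R where "finite R" and "R \<subseteq> S" and "\<And>q. q \<in> S \<Longrightarrow> \<exists>r\<in>R. isomorphic_supobjects C r q"
proof -
  define rel where "rel = {(q, q'). q \<in> S \<and> q' \<in> S \<and> isomorphic_supobjects C q q'}"
  have quot: "supobject_iso_classes C S = (\<lambda>q. rel `` {q}) ` S"
    by (auto simp: supobject_iso_classes_def rel_def quotient_def)
  obtain R where R: "R \<subseteq> S" "finite R" "(\<lambda>q. rel `` {q}) ` S = (\<lambda>q. rel `` {q}) ` R"
    using finite_subset_image[OF fin, of "\<lambda>q. rel `` {q}" S] quot by auto
  have "\<exists>r\<in>R. isomorphic_supobjects C r q" if "q \<in> S" for q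
  proof -
    have "rel `` {q} \<in> (\<lambda>q. rel `` {q}) ` R" using R(3) that by blast
    then obtain r where r: "r \<in> R" "rel `` {q} = rel `` {r}" by blast
    have "q \<in> rel `` {q}"
      using that S isomorphic_supobjects_refl by (auto simp: rel_def)
    then show ?thesis using r by (auto simp: rel_def)
  qed
  then show ?thesis using that R by blast
qed

end

context locally_finite_category
begin

text \<open>
  The composite \<open>f \<cdot> g\<close> is a monomorphism from \<open>B\<close> to itself, so composition with it is an injective
  self-map of the finite set \<open>Hom C B B\<close>, hence surjective, and the identity is in its image. Thus
  \<open>f\<close> has a right inverse, and a monomorphism with a right inverse is an isomorphism.
\<close>

lemma isomorphic_objects_if_monos_both_ways:
  assumes mf: "mono_arr C f" and mg: "mono_arr C g"
    and f: "f \<in> Hom C A B" and g: "g \<in> Hom C B A"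
  shows "isomorphic_objects C A B"
proof -
  have A: "A \<in> Obj C" and B: "B \<in> Obj C" using Hom_Obj[OF f] .
  have fg: "f \<cdot> g \<in> Hom C B B" using Comp_in_Hom[OF g f] .
  have "inj_on (\<lambda>u. (f \<cdot> g) \<cdot> u) (Hom C B B)"
    using mono_arr_cancel[OF mono_arr_Comp[OF mg mf g f] fg] by (auto intro: inj_onI)
  moreover have "(\<lambda>u. (f \<cdot> g) \<cdot> u) ` Hom C B B \<subseteq> Hom C B B"
    using Comp_in_Hom[OF _ fg] by blast
  ultimately have "(\<lambda>u. (f \<cdot> g) \<cdot> u) ` Hom C B B = Hom C B B"
    using endo_inj_surj[OF finite_Hom[OF B B]] by blast
  then obtain u where u: "u \<in> Hom C B B" and fgu: "(f \<cdot> g) \<cdot> u = Id C B"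
    using Id_in_Hom[OF B] by (metis imageE)
  define k where "k = g \<cdot> u"
  have k: "k \<in> Hom C B A" using Comp_in_Hom[OF u g] k_def by simp
  have fk: "f \<cdot> k = Id C B" using Comp_assoc[OF u g f] fgu k_def by simp
  have "f \<cdot> (k \<cdot> f) = f \<cdot> Id C A"
    using Comp_assoc[OF f k f] fk Id_Comp[OF f] Comp_Id[OF f] by simp
  then have "k \<cdot> f = Id C A"
    using mono_arr_cancel[OF mf f Comp_in_Hom[OF f k] Id_in_Hom[OF A]] by blast
  then have "iso_arr C f"
    unfolding iso_arr_def Hom_DomCod[OF f] using f k fk by (auto simp: Hom_def)
  then show ?thesis using f by (auto simp: isomorphic_objects_def)
qed

text \<open>
  The pushout \<open>P\<close> of the members of \<open>T\<close> does not depend on the target, and both counts are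
  numbers of morphisms out of \<open>P\<close>.
\<close>

lemma card_factoring_eq:
  assumes Hom_eq: "\<And>Y. Y \<in> Obj C \<Longrightarrow> card (Hom C Y A) = card (Hom C Y B)"
    and S: "S \<subseteq> supobjects C X"
    and pushouts: "\<And>m e. (\<And>i. i \<in> {1..m} \<Longrightarrow> e i \<in> S) \<Longrightarrow> \<exists>P p j. is_pushout C X m e P p j"
    and T: "finite T" "T \<subseteq> S"
  shows "card {f \<in> Hom C X A. \<forall>q\<in>T. factors_through C f q}
       = card {f \<in> Hom C X B. \<forall>q\<in>T. factors_through C f q}"
proof -
  obtain e where "bij_betw e {1..card T} T" using ex_bij_betw_nat_finite_1[OF T(1)] by blast
  then have eT: "T = e ` {1..card T}" by (simp add: bij_betw_def)
  have eS: "e i \<in> S" if "i \<in> {1..card T}" for i using that T(2) eT by blast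
  obtain P p j where po: "is_pushout C X (card T) e P p j" using pushouts[of "card T" e] eS by blast
  have "card {f \<in> Hom C X Y. \<forall>q\<in>T. factors_through C f q} = card (Hom C P Y)" for Y
  proof -
    have "(\<forall>q\<in>T. factors_through C f q) \<longleftrightarrow> (\<forall>i\<in>{1..card T}. factors_through C f (e i))" for f
      by (subst eT) (rule ball_simps)
    then show ?thesis
      using bij_betw_same_card[OF bij_betw_pushout_factoring[OF po subsetD[OF S eS], of Y]] by simp
  qed
  moreover have "P \<in> Obj C" using po by (auto simp: is_pushout_def is_cocone_def)
  ultimately show ?thesis using Hom_eq by simp
qed

lemma card_factoring_through_none_eq:
  assumes X: "X \<in> Obj C" and A: "A \<in> Obj C" and B: "B \<in> Obj C"
    and Hom_eq: "\<And>Y. Y \<in> Obj C \<Longrightarrow> card (Hom C Y A) = card (Hom C Y B)"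
    and S: "S \<subseteq> supobjects C X"
    and pushouts: "\<And>m e. (\<And>i. i \<in> {1..m} \<Longrightarrow> e i \<in> S) \<Longrightarrow> \<exists>P p j. is_pushout C X m e P p j"
    and fin: "finite (supobject_iso_classes C S)"
  shows "card {f \<in> Hom C X A. \<forall>q\<in>S. \<not> factors_through C f q}
       = card {f \<in> Hom C X B. \<forall>q\<in>S. \<not> factors_through C f q}"
proof -
  obtain R where R: "finite R" "R \<subseteq> S" "\<And>q. q \<in> S \<Longrightarrow> \<exists>r\<in>R. isomorphic_supobjects C r q"
    using finite_supobject_representatives[OF S fin] by metis
  have reps: "{f \<in> Hom C X Y. \<forall>q\<in>S. \<not> factors_through C f q}
      = {f \<in> Hom C X Y. \<forall>q\<in>R. \<not> factors_through C f q}" for Y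
    using R(2) R(3) S factors_through_isomorphic_supobject by blast
  \<comment> \<open>With nothing to satisfy, only the conditions to avoid remain.\<close>
  have "card {f \<in> Hom C X A. (\<forall>q\<in>{}. factors_through C f q) \<and> (\<forall>q\<in>R. \<not> factors_through C f q)}
      = card {f \<in> Hom C X B. (\<forall>q\<in>{}. factors_through C f q) \<and> (\<forall>q\<in>R. \<not> factors_through C f q)}"
    using card_factoring_eq[OF Hom_eq S pushouts]
    by (intro card_avoiding_eq[where R = S] finite_Hom X A B R) auto
  then show ?thesis unfolding reps by simp
qed

end

theorem theorem2p11:
  fixes C :: "('o, 'm) cat"
    and I :: "'m set"
    and M :: "'o \<Rightarrow> 'm set"
  assumes "locally_finite_category C"
    and I_monos: "\<And>f. f \<in> I \<Longrightarrow> mono_arr C f"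
    and I_Id: "\<And>X. X \<in> Obj C \<Longrightarrow> Id C X \<in> I"
    and M_supobjects: "\<And>X. X \<in> Obj C \<Longrightarrow> M X \<subseteq> supobjects C X"
    and pushouts: "\<And>X m e. \<lbrakk>X \<in> Obj C; \<And>i. i \<in> {1..m} \<Longrightarrow> e i \<in> M X\<rbrakk>
      \<Longrightarrow> \<exists>P p j. is_pushout C X m e P p j"
    and finite_classes: "\<And>X. X \<in> Obj C \<Longrightarrow> finite (supobject_iso_classes C (M X))"
    and not_I_factors: "\<And>X Y f. \<lbrakk>X \<in> Obj C; Y \<in> Obj C; f \<in> Hom C X Y; f \<notin> I\<rbrakk>
      \<Longrightarrow> \<exists>q\<in>M X. factors_through C f q"
    and factors_not_I: "\<And>X Y f q. \<lbrakk>X \<in> Obj C; Y \<in> Obj C; f \<in> Hom C X Y; q \<in> M X;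
      factors_through C f q\<rbrakk> \<Longrightarrow> f \<notin> I"
  shows "combinatorial_category C"
proof -
  interpret locally_finite_category C by fact
  have I_char: "{f \<in> Hom C X Y. \<forall>q\<in>M X. \<not> factors_through C f q} = Hom C X Y \<inter> I"
    if "X \<in> Obj C" "Y \<in> Obj C" for X Y
    using not_I_factors[OF that] factors_not_I[OF that] by blast
  \<comment> \<open>The count of \<open>I\<close>-monos from \<open>A\<close> is positive at \<open>A\<close> itself, hence also at \<open>B\<close>.\<close>
  have ex_I_mono: "\<exists>f\<in>Hom C A B. f \<in> I"
    if A: "A \<in> Obj C" and B: "B \<in> Obj C"
      and eq: "\<And>Y. Y \<in> Obj C \<Longrightarrow> card (Hom C Y A) = card (Hom C Y B)" for A B
  proof -
    have "card (Hom C A A \<inter> I) = card (Hom C A B \<inter> I)"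
      using card_factoring_through_none_eq[OF A A B eq M_supobjects[OF A] pushouts[OF A]
          finite_classes[OF A]] I_char[OF A A] I_char[OF A B] by simp
    moreover have "card (Hom C A A \<inter> I) \<noteq> 0"
      using finite_Hom[OF A A] Id_in_Hom[OF A] I_Id[OF A] by auto
    ultimately have "Hom C A B \<inter> I \<noteq> {}" by auto
    then show ?thesis by blast
  qed
  show ?thesis
  proof unfold_locales
    fix A B
    assume A: "A \<in> Obj C" and B: "B \<in> Obj C"
      and eq: "\<forall>X\<in>Obj C. card (Hom C X A) = card (Hom C X B)"
    obtain f where "f \<in> Hom C A B" "f \<in> I" using ex_I_mono[OF A B] eq by blast
    moreover obtain g where "g \<in> Hom C B A" "g \<in> I" using ex_I_mono[OF B A] eq by metis
    ultimately show "isomorphic_objects C A B"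
      using isomorphic_objects_if_monos_both_ways I_monos by blast
  qed
qed

end
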